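(* Let $n\ge1$ be an integer and let $\mathbf a=(a_1,\dots,a_{n+1})\in\mathbb R^{n+1}$ be a unit vector with $\sum_{j=1}^{n+1}a_j=0$ whose coordinates take exactly two distinct values. Then $$\mathrm{Vol}_{n-1}(\Delta_n\cap\mathbf a^\perp)\;\ge\; V_{\min}:=\frac{\sqrt{n+1}}{(n-1)!}\Big(\frac{n}{n+1}\Big)^{n-\frac12}.$$ Equality holds only if $\mathbf a$ is obtained, up to permutation of coordinates and multiplication by $-1$, from $$\mathbf a_{\min}:=\Big(\sqrt{\tfrac{n}{n+1}},\,-\tfrac{1}{\sqrt{n(n+1)}},\,\ldots,\,-\tfrac{1}{\sqrt{n(n+1)}}\Big)\in\mathbb R^{n+1}.$$
   Context: $\Delta_n$ is the standard regular simplex, i.e. the convex hull of the standard basis vectors $\mathbf e_1,\dots,\mathbf e_{n+1}$ of $\mathbb R^{n+1}$. $\mathbf a^\perp$ is the linear hyperplane orthogonal to $\mathbf a$. $\mathrm{Vol}_{n-1}$ denotes $(n-1)$-dimensional volume (counting measure if $n=1$). *)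

theory Defs
  imports "HOL-Analysis.Analysis"
begin

definition flat_frame :: "nat \<Rightarrow> 'a::euclidean_space set \<Rightarrow> 'a \<Rightarrow> (nat \<Rightarrow> 'a) \<Rightarrow> bool" where
  "flat_frame k S p b \<longleftrightarrow>
     (\<forall>i<k. \<forall>j<k. b i \<bullet> b j = (if i = j then 1 else 0)) \<and>
     S \<subseteq> {p + (\<Sum>i<k. x i *\<^sub>R b i) | x. True}"

(* k-dimensional volume of a set contained in some k-dimensional affine subspace: the Lebesgue
   measure on R^k of the set written in orthonormal coordinates of that subspace.  R^k is modelled
   by the extensional functions on {..<k}, so that k = 0 is covered: there the space is a single
   point of measure 1, i.e. Vol 0 is the counting measure.  The value does not depend on the frame.
   Sets not contained in a k-dimensional affine subspace get an unspecified value. *)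
definition Vol :: "nat \<Rightarrow> 'a::euclidean_space set \<Rightarrow> real" where
  "Vol k S =
     (let (p, b) = (SOME (p, b). flat_frame k S p b)
      in measure (completion (PiM {..<k} (\<lambda>_. lborel)))
           {x \<in> {..<k} \<rightarrow>\<^sub>E UNIV. p + (\<Sum>i<k. x i *\<^sub>R b i) \<in> S})"

lemma flat_frame_exists:
  fixes S :: "'a::euclidean_space set"
  assumes dimS: "aff_dim S \<le> int k" and k: "k \<le> DIM('a)"
  shows "\<exists>p b. flat_frame k S p b"
proof -
  obtain p where p: "S \<noteq> {} \<Longrightarrow> p \<in> S" by (cases "S = {}") auto
  define W where "W = (if S = {} then {0} else span ((\<lambda>x. - p + x) ` S))"
  have subW: "subspace W" by (simp add: W_def)
  have dimW: "dim W \<le> k"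
  proof (cases "S = {}")
    case True
    then show ?thesis by (simp add: W_def)
  next
    case False
    then have "p \<in> affine hull S" using p hull_inc by fast
    then show ?thesis using dimS aff_dim_eq_dim[of p S] False by (simp add: W_def dim_span)
  qed
  obtain B where B: "B \<subseteq> W" "pairwise orthogonal B" "\<And>x. x \<in> B \<Longrightarrow> norm x = 1"
      "independent B" "card B = dim W" "span B = W"
    by (rule orthonormal_basis_subspace[OF subW]) blast
  let ?W' = "{y. \<forall>x\<in>W. orthogonal x y}"
  obtain T where T: "T \<subseteq> ?W'" "pairwise orthogonal T" "\<And>x. x \<in> T \<Longrightarrow> norm x = 1"
      "independent T" "card T = dim ?W'" "span T = ?W'"
    by (rule orthonormal_basis_subspace[OF subspace_orthogonal_to_vectors[of W]]) blast
  have BT: "orthogonal x y" if "x \<in> B" "y \<in> T" for x y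
  proof -
    have "x \<in> W" using that(1) B(1) by blast
    then show ?thesis using that(2) T(1) by auto
  qed
  have disj: "B \<inter> T = {}"
    proof -
    have False if "x \<in> B" "x \<in> T" for x
      using BT[OF that] B(3)[OF that(1)] by (simp add: orthogonal_self)
    then show ?thesis by blast
  qed
  have orth: "pairwise orthogonal (B \<union> T)"
    using B(2) T(2) BT orthogonal_commute unfolding pairwise_def by (metis Un_iff)
  have fin: "finite (B \<union> T)"
    using B(4) T(4) independent_imp_finite by blast
  have "card (B \<union> T) = DIM('a)"
    using dim_subspace_orthogonal_to_vectors[OF subW subspace_UNIV subset_UNIV]
      card_Un_disjoint[of B T] fin disj B(5) T(5) by simp
  then obtain D where D: "B \<subseteq> D" "D \<subseteq> B \<union> T" "card D = k"
    using exists_subset_between[of B k "B \<union> T"] dimW B(5) k fin by auto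
  then have "finite D" using fin finite_subset by blast
  then obtain b where b: "bij_betw b {..<k} D"
    using ex_bij_betw_nat_finite[of D] D(3) by (auto simp: atLeast0LessThan)
  have ortho: "b i \<bullet> b j = (if i = j then 1 else 0)" if "i < k" "j < k" for i j
  proof -
    have mem: "b i \<in> B \<union> T" "b j \<in> B \<union> T"
      using that b D(2) by (auto simp: bij_betw_def)
    show ?thesis
    proof (cases "i = j")
      case True
      then show ?thesis using mem B(3) T(3) by (auto simp: dot_square_norm)
    next
      case False
      then have "b i \<noteq> b j"
        using b that by (auto simp: bij_betw_def inj_on_def)
      then show ?thesis using False orth mem by (auto simp: pairwise_def orthogonal_def)
    qed
  qed
  have "\<exists>x. y = p + (\<Sum>i<k. x i *\<^sub>R b i)" if "y \<in> S" for y
  proof -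
    have "- p + y \<in> W"
      using that by (auto simp: W_def intro: span_base)
    then have "y - p \<in> W" by simp
    then have "y - p \<in> span D" using B(6) span_mono[OF D(1)] by auto
    then obtain u where "y - p = (\<Sum>v\<in>D. u v *\<^sub>R v)"
      unfolding span_finite[OF \<open>finite D\<close>] by blast
    also have "\<dots> = (\<Sum>i<k. u (b i) *\<^sub>R b i)"
      using sum.reindex_bij_betw[OF b, of "\<lambda>v. u v *\<^sub>R v"] by simp
    finally show ?thesis by (intro exI[of _ "\<lambda>i. u (b i)"]) (simp add: algebra_simps)
  qed
  then have "flat_frame k S p b"
    using ortho by (auto simp: flat_frame_def)
  then show ?thesis by blast
qed

definition std_simplex :: "(real ^ 'n) set" where
  "std_simplex = convex hull (range (\<lambda>i. axis i 1))"

definition orth_hyperplane :: "real ^ 'n \<Rightarrow> (real ^ 'n) set" where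
  "orth_hyperplane a = {x. a \<bullet> x = 0}"

definition V_min :: "nat \<Rightarrow> real" where
  "V_min n = sqrt (real n + 1) / fact (n - 1) * (real n / (real n + 1)) powr (real n - 1 / 2)"

(* The index type carries no order; k is the index playing the role of the first coordinate. *)
definition a_min :: "nat \<Rightarrow> 'n \<Rightarrow> real ^ 'n" where
  "a_min n k = (\<chi> j. if j = k then sqrt (real n / (real n + 1))
                       else - (1 / sqrt (real n * (real n + 1))))"

end

theory Submission
  imports Defs
begin

text \<open>If a takes its two values on blocks of sizes p and q, with p + q = n + 1, the slice is the
  product of the standard simplices of the two blocks, scaled by p/(n+1) and q/(n+1).  Its volume is
  F(p) F(q) / (n+1)^(n-1) with F(p) = p^(p-1/2) / (p-1)!, independently of the chosen orthonormal
  frame.  Since F(p+1)/F(p) = (1 + 1/p)^(p+1/2) is strictly decreasing in p, ln F is strictly concave,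
  so F(p) F(q) is at least F(1) F(n), strictly if both blocks have at least two elements.\<close>

text \<open>The slice has codimension two and \<open>Vol\<close> measures it in a frame picked by
  \<open>SOME\<close>, so its volume has to be computed for every frame at once. Thickening the
  slice by unit segments along the two normalised block vectors keeps the number and makes the set
  full-dimensional, where rigid motions and determinants act on Lebesgue measure. The determinant
  supplies the square roots of p and q in F(p) F(q). For n = 1 the slice is a point, and the same
  computation applies because the product measure over the empty index set has mass one.

  The scales p/(n+1) and q/(n+1) come from the zero coordinate sum, which says p \<alpha> + q
  \<beta> = 0. The exponent p + 1/2 of the ratio ties its monotonicity to the trapezoidal rule for
  1/t: that rule is strict on every interval of length one, and this strictness settles the case of
  equality.\<close>

section \<open>Lebesgue measure in coordinates\<close>

text \<open>Pulling the set back along \<open>merge I J\<close> gives the rectangle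
  \<open>A \<times> B\<close>, and \<open>merge\<close> carries the pair measure to the product over
  the union.\<close>

lemma (in product_sigma_finite) emeasure_PiM_Un:
  assumes "finite I" "finite J" "I \<inter> J = {}"
    and A: "A \<in> sets (PiM I M)" and B: "B \<in> sets (PiM J M)"
  shows "emeasure (PiM (I \<union> J) M) {x \<in> space (PiM (I \<union> J) M). restrict x I \<in> A \<and> restrict x J \<in> B} =
           emeasure (PiM I M) A * emeasure (PiM J M) B"
proof -
  interpret J: finite_product_sigma_finite M J by standard fact
  have m [measurable]: "(\<lambda>x. restrict x I) \<in> measurable (PiM (I \<union> J) M) (PiM I M)"
    "(\<lambda>x. restrict x J) \<in> measurable (PiM (I \<union> J) M) (PiM J M)"
    by (auto intro: measurable_restrict_subset)
  have S: "{x \<in> space (PiM (I \<union> J) M). restrict x I \<in> A \<and> restrict x J \<in> B} \<in> sets (PiM (I \<union> J) M)"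
    (is "?S \<in> _")
    using A B by measurable
  have mem: "merge I J (x, y) \<in> ?S \<longleftrightarrow> x \<in> A \<and> y \<in> B"
    if "x \<in> space (PiM I M)" "y \<in> space (PiM J M)" for x y
  proof -
    have "merge I J (x, y) \<in> space (PiM (I \<union> J) M)"
      using that by (auto simp: space_PiM PiE_iff merge_def extensional_def)
    moreover have "restrict (merge I J (x, y)) I = x" "restrict (merge I J (x, y)) J = y"
      using that assms(3) by (auto simp: space_PiM PiE_iff merge_def extensional_def fun_eq_iff)
    ultimately show ?thesis by simp
  qed
  have "merge I J -` ?S \<inter> space (PiM I M \<Otimes>\<^sub>M PiM J M) = A \<times> B"
    using mem sets.sets_into_space[OF A] sets.sets_into_space[OF B]
    by (auto simp: space_pair_measure simp del: mem_Collect_eq)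
  then have "emeasure (PiM (I \<union> J) M) ?S = emeasure (PiM I M \<Otimes>\<^sub>M PiM J M) (A \<times> B)"
    by (subst distr_merge[OF assms(3,1,2), symmetric])
       (simp add: emeasure_distr[OF measurable_merge S])
  then show ?thesis
    using A B by (simp add: J.emeasure_pair_measure_Times)
qed

text \<open>Renaming coordinates along a bijection sends boxes to boxes with the same factors, and
  boxes determine a finite product measure. It later relabels frame coordinates in
  \<open>{..<k}\<close> by indices of the vector type.\<close>

lemma (in product_sigma_finite) emeasure_PiM_reindex:
  assumes f: "bij_betw f I J" and fin: "finite I" and A: "A \<in> sets (PiM I (\<lambda>i. M (f i)))"
  shows "emeasure (PiM J M) {x \<in> space (PiM J M). (\<lambda>i\<in>I. x (f i)) \<in> A} =
           emeasure (PiM I (\<lambda>i. M (f i))) A"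
proof -
  interpret I: product_sigma_finite "\<lambda>i. M (f i)" by standard
  have J: "finite J" using f fin bij_betw_finite by blast
  have fJ: "f i \<in> J" if "i \<in> I" for i using f that bij_betwE by blast
  let ?g = "\<lambda>x. \<lambda>i\<in>I. x (f i)"
  have g [measurable]: "?g \<in> measurable (PiM J M) (PiM I (\<lambda>i. M (f i)))"
    by (intro measurable_restrict measurable_component_singleton fJ)
  have "distr (PiM J M) (PiM I (\<lambda>i. M (f i))) ?g = PiM I (\<lambda>i. M (f i))"
  proof (rule I.PiM_eqI[OF fin])
    fix B assume B: "\<And>i. i \<in> I \<Longrightarrow> B i \<in> sets (M (f i))"
    let ?h = "inv_into I f"
    have h: "?h j \<in> I" "f (?h j) = j" if "j \<in> J" for j
      using f that by (auto simp: bij_betw_def inv_into_into f_inv_into_f)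
    have hf: "?h (f i) = i" if "i \<in> I" for i
      using f that by (auto simp: bij_betw_def)
    have B': "B (?h j) \<in> sets (M j)" if "j \<in> J" for j
      using B[OF h(1)[OF that]] h(2)[OF that] by simp
    have "?g -` Pi\<^sub>E I B \<inter> space (PiM J M) = Pi\<^sub>E J (\<lambda>j. B (?h j))"
    proof (intro equalityI subsetI)
      fix x assume x: "x \<in> ?g -` Pi\<^sub>E I B \<inter> space (PiM J M)"
      have "x j \<in> B (?h j)" if "j \<in> J" for j
        using x h[OF that] by (auto simp: PiE_iff dest!: bspec[of I _ "?h j"])
      then show "x \<in> Pi\<^sub>E J (\<lambda>j. B (?h j))"
        using x by (auto simp: space_PiM PiE_iff)
    next
      fix x assume x: "x \<in> Pi\<^sub>E J (\<lambda>j. B (?h j))"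
      then have "x j \<in> space (M j)" if "j \<in> J" for j
        using that sets.sets_into_space[OF B'[OF that]] by (auto simp: PiE_iff)
      moreover have "x (f i) \<in> B i" if "i \<in> I" for i
        using x fJ[OF that] hf[OF that] by (auto simp: PiE_iff dest!: bspec[of J _ "f i"])
      ultimately show "x \<in> ?g -` Pi\<^sub>E I B \<inter> space (PiM J M)"
        using x by (auto simp: space_PiM PiE_iff)
    qed
    then have "emeasure (distr (PiM J M) (PiM I (\<lambda>i. M (f i))) ?g) (Pi\<^sub>E I B) =
        (\<Prod>j\<in>J. emeasure (M j) (B (?h j)))"
      using B B' by (simp add: emeasure_distr[OF g] sets_PiM_I_finite fin emeasure_PiM J)
    also have "\<dots> = (\<Prod>i\<in>I. emeasure (M (f i)) (B i))"
      by (subst prod.reindex_bij_betw[OF f, symmetric]) (simp add: hf)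
    finally show "emeasure (distr (PiM J M) (PiM I (\<lambda>i. M (f i))) ?g) (Pi\<^sub>E I B) =
        (\<Prod>i\<in>I. emeasure (M (f i)) (B i))" .
  qed simp
  then show ?thesis
    using emeasure_distr[OF g A] by (simp add: vimage_def Int_def conj_commute)
qed

lemma borel_measurable_vec_lambda:
  "(\<lambda>f. \<chi> i. f i) \<in> measurable (PiM UNIV (\<lambda>_::'n::finite. lborel :: real measure)) borel"
  by (subst borel_measurable_euclidean_space)
    (auto simp: Basis_vec_def inner_axis intro!: measurable_component_singleton[THEN measurable_compose])

text \<open>Values on boxes determine \<open>lborel\<close>. The identity links frame coordinates,
  which are extensional functions measured by \<open>PiM\<close>, with vectors, on which matrices
  act.\<close>

lemma lborel_vec_eq:
  "(lborel :: (real ^ 'n) measure) = distr (PiM UNIV (\<lambda>_. lborel)) borel (\<lambda>f. \<chi> i. f i)"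
proof (rule lborel_eqI)
  interpret product_sigma_finite "\<lambda>_::'n. lborel :: real measure" by standard
  have Basis: "(Basis :: (real ^ 'n) set) = range (\<lambda>i. axis i 1)"
    by (auto simp: Basis_vec_def)
  have inj: "inj (\<lambda>i::'n. axis i (1::real))"
    by (simp add: inj_on_def axis_eq_axis)
  fix l u :: "real ^ 'n" assume le: "\<And>b. b \<in> Basis \<Longrightarrow> l \<bullet> b \<le> u \<bullet> b"
  have le: "l $ i \<le> u $ i" for i
    using le[of "axis i 1"] by (auto simp: inner_axis Basis_vec_def)
  have "(\<lambda>f. \<chi> i. f i) -` box l u \<inter> space (PiM UNIV (\<lambda>_::'n. lborel :: real measure)) =
        (\<Pi>\<^sub>E i\<in>UNIV. {l $ i <..< u $ i})"
    by (auto simp: mem_box_cart space_PiM PiE_iff)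
  then have "emeasure (distr (PiM UNIV (\<lambda>_. lborel)) borel (\<lambda>f. \<chi> i. f i)) (box l u) =
      (\<Prod>i\<in>UNIV. ennreal (u $ i - l $ i))"
    by (simp add: emeasure_distr[OF borel_measurable_vec_lambda] emeasure_PiM le)
  also have "\<dots> = (\<Prod>b\<in>Basis. (u - l) \<bullet> b)"
    using le by (simp add: prod_ennreal Basis inner_axis prod.reindex[OF inj])
  finally show "emeasure (distr (PiM UNIV (\<lambda>_. lborel)) borel (\<lambda>f. \<chi> i. f i)) (box l u) =
      (\<Prod>b\<in>Basis. (u - l) \<bullet> b)" .
qed simp

text \<open>The coordinates i and j range over unit intervals and contribute the factor one. A
  volume of codimension two thus becomes a Lebesgue measure in the full space.\<close>

lemma measure_lborel_vec_cylinder: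
  fixes i j :: "'n :: finite"
  assumes "i \<noteq> j" and A: "A \<in> sets (PiM (- {i, j}) (\<lambda>_. lborel))"
  defines "C \<equiv> {x :: real ^ 'n. (\<lambda>l\<in>- {i, j}. x $ l) \<in> A \<and> x $ i \<in> {0..1} \<and> x $ j \<in> {0..1}}"
  assumes C: "C \<in> sets borel"
  shows "measure lborel C = measure (PiM (- {i, j}) (\<lambda>_. lborel)) A"
proof -
  interpret product_sigma_finite "\<lambda>_::'n. lborel :: real measure" by standard
  let ?B = "Pi\<^sub>E {i, j} (\<lambda>_. {0..1::real})"
  have nth: "($) (vec_lambda x) = x" for x :: "'n \<Rightarrow> real"
    by (rule ext) simp
  have UN: "- {i, j} \<union> {i, j} = UNIV" by auto
  have B: "?B \<in> sets (PiM {i, j} (\<lambda>_. lborel))"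
    by (intro sets_PiM_I_finite) auto
  have "emeasure lborel C = emeasure (PiM UNIV (\<lambda>_. lborel))
      ((\<lambda>f. \<chi> i. f i) -` C \<inter> space (PiM UNIV (\<lambda>_. lborel)))"
    by (subst lborel_vec_eq) (rule emeasure_distr[OF borel_measurable_vec_lambda C])
  also have "(\<lambda>f. \<chi> i. f i) -` C \<inter> space (PiM UNIV (\<lambda>_. lborel)) =
      {x \<in> space (PiM UNIV (\<lambda>_. lborel)). restrict x (- {i, j}) \<in> A \<and> restrict x {i, j} \<in> ?B}"
    by (rule set_eqI) (simp add: C_def PiE_iff conj_commute nth)
  also have "emeasure (PiM UNIV (\<lambda>_. lborel)) \<dots> =
      emeasure (PiM (- {i, j}) (\<lambda>_. lborel)) A * emeasure (PiM {i, j} (\<lambda>_. lborel)) ?B"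
    using emeasure_PiM_Un[of "- {i, j}" "{i, j}", OF _ _ _ A B, unfolded UN] by simp
  also have "emeasure (PiM {i, j} (\<lambda>_. lborel)) ?B = 1"
    by (subst emeasure_PiM) (auto simp: assms(1))
  finally show ?thesis by (simp add: measure_def)
qed

lemma sets_corner_simplex:
  assumes "finite I"
  shows "{x \<in> space (PiM I (\<lambda>_. lborel)). (\<forall>i\<in>I. 0 \<le> x i) \<and> sum x I \<le> (t::real)} \<in> sets (PiM I (\<lambda>_. lborel))"
  using assms by measurable

text \<open>The two sum constraints act on disjoint sets of coordinates, so the measure factors into
  two corner simplices, each of volume t^d / d! in dimension d.\<close>

lemma
  fixes I J :: "'a set" and s t :: real
  assumes fin: "finite I" "finite J" and "I \<inter> J = {}"
  defines "S \<equiv> {x \<in> space (PiM (I \<union> J) (\<lambda>_. lborel)).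
              (\<forall>i\<in>I \<union> J. 0 \<le> x i) \<and> sum x I \<le> s \<and> sum x J \<le> t}"
  shows sets_corner_simplices: "S \<in> sets (PiM (I \<union> J) (\<lambda>_. lborel))"
    and measure_corner_simplices: "0 \<le> s \<Longrightarrow> 0 \<le> t \<Longrightarrow>
         measure (PiM (I \<union> J) (\<lambda>_. lborel)) S = s ^ card I / fact (card I) * (t ^ card J / fact (card J))"
proof -
  interpret product_sigma_finite "\<lambda>_::'a. lborel :: real measure" by standard
  let ?S = "\<lambda>I t. {x \<in> space (PiM I (\<lambda>_. lborel)). (\<forall>i\<in>I. 0 \<le> x i) \<and> sum x I \<le> (t::real)}"
  have eq: "S = {x \<in> space (PiM (I \<union> J) (\<lambda>_. lborel)). restrict x I \<in> ?S I s \<and> restrict x J \<in> ?S J t}"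
    by (auto simp: S_def space_PiM)
  have m [measurable]: "(\<lambda>x. restrict x I) \<in> measurable (PiM (I \<union> J) (\<lambda>_. lborel)) (PiM I (\<lambda>_. lborel))"
    "(\<lambda>x. restrict x J) \<in> measurable (PiM (I \<union> J) (\<lambda>_. lborel)) (PiM J (\<lambda>_. lborel :: real measure))"
    by (auto intro: measurable_restrict_subset)
  note S' [measurable] = sets_corner_simplex[OF fin(1), of s] sets_corner_simplex[OF fin(2), of t]
  show "S \<in> sets (PiM (I \<union> J) (\<lambda>_. lborel))"
    unfolding eq by measurable
  have S: "emeasure (PiM I (\<lambda>_. lborel)) (?S I t) = ennreal (t ^ card I / fact (card I))"
    if "finite I" "0 \<le> t" for I :: "'a set" and t
    using emeasure_std_simplex_aux[OF that] by (simp add: Int_def conj_commute)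
  show "measure (PiM (I \<union> J) (\<lambda>_. lborel)) S = s ^ card I / fact (card I) * (t ^ card J / fact (card J))"
    if "0 \<le> s" "0 \<le> t"
    unfolding eq measure_def using emeasure_PiM_Un[OF assms(1-3) S'] that
    by (simp add: S fin ennreal_mult[symmetric])
qed

section \<open>The volume of a product of two simplices\<close>

text \<open>The columns are the edges from the vertices i0 and j0 inside each block together with the two
  unit block vectors.  Four applications of the column replacement rule behind Cramer's rule reduce
  the determinant to that of the identity; the edge part is obtained as a transpose.\<close>

lemma det_block_edge_matrix:
  fixes P Q :: "'n::finite set"
  assumes i0: "i0 \<in> P" and j0: "j0 \<in> Q" and disj: "P \<inter> Q = {}"
  shows "det ((\<chi> i j. if j = i0 then if i \<in> P then 1 / sqrt (card P) else 0
                      else if j = j0 then if i \<in> Q then 1 / sqrt (card Q) else 0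
                      else if i = j then 1
                      else if i = i0 \<and> j \<in> P \<or> i = j0 \<and> j \<in> Q then - 1 else 0) :: real ^ 'n ^ 'n) =
         sqrt (card P) * sqrt (card Q)"
    (is "det ?B = _")
proof -
  have ne: "i0 \<noteq> j0" "i0 \<notin> Q" "j0 \<notin> P" using assms by auto
  define u :: "'n set \<Rightarrow> 'n \<Rightarrow> real ^ 'n"
    where "u R l = (\<chi> i. if i = l then 1 else if i \<in> R then - 1 else 0)" for R l
  \<comment> \<open>The vectors \<open>w P i0\<close> and \<open>w Q j0\<close> solve
    \<open>A0 *v x = e P\<close> and \<open>A0 *v x = e Q\<close>. Off l the entries must be those
    of \<open>e R\<close>; row l then forces the entry \<open>sqrt (card R)\<close>, which is the
    factor that Cramer's rule contributes.\<close>
  define w :: "'n set \<Rightarrow> 'n \<Rightarrow> real ^ 'n"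
    where "w R l = (\<chi> i. if i = l then sqrt (card R) else if i \<in> R then 1 / sqrt (card R) else 0)" for R l
  define e :: "'n set \<Rightarrow> real ^ 'n"
    where "e R = (\<chi> i. if i \<in> R then 1 / sqrt (card R) else 0)" for R
  define B1 where "B1 = (\<chi> i j. if j = i0 then u P i0 $ i else mat 1 $ i $ j)"
  define B2 where "B2 = (\<chi> i j. if j = j0 then u Q j0 $ i else B1 $ i $ j)"
  define A0 where "A0 = transpose B2"
  define A1 where "A1 = (\<chi> i j. if j = i0 then e P $ i else A0 $ i $ j)"
  have "det B1 = 1"
    using cramer_lemma[of i0 "mat 1" "u P i0"] by (simp add: B1_def u_def cong: if_cong)
  have "B1 *v u Q j0 = u Q j0"
  proof -
    have "(\<Sum>j\<in>UNIV. B1 $ i $ j * u Q j0 $ j) = (\<Sum>j\<in>UNIV. if j = i then u Q j0 $ j else 0)" for i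
      using ne by (intro sum.cong) (auto simp: B1_def u_def mat_def)
    then show ?thesis by (simp add: vec_eq_iff matrix_vector_mult_def)
  qed
  then have "det B2 = 1"
    using cramer_lemma[of j0 B1 "u Q j0"] \<open>det B1 = 1\<close> by (simp add: B2_def u_def cong: if_cong)
  then have A0: "det A0 = 1" by (simp add: A0_def)
  have A0_eq: "A0 $ i $ j = (if i = j0 then u Q j0 $ j else if i = i0 then u P i0 $ j
      else if i = j then 1 else 0)" for i j
    using ne by (auto simp: A0_def B2_def B1_def transpose_def mat_def)
  have uw: "(\<Sum>j\<in>UNIV. u R l $ j * w R l $ j) = e R $ l" if "l \<in> R" for R l
  proof -
    have pos: "0 < real (card R)" using that by (auto simp: card_gt_0_iff)
    have R: "real (card (R - {l})) = real (card R) - 1"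
      using that pos by (simp add: of_nat_diff Suc_leI)
    have "(\<Sum>j\<in>UNIV. u R l $ j * w R l $ j) = (\<Sum>j\<in>R. u R l $ j * w R l $ j)"
      using that by (intro sum.mono_neutral_right) (auto simp: u_def w_def)
    also have "\<dots> = sqrt (card R) + (\<Sum>j\<in>R - {l}. - (1 / sqrt (card R)))"
      using that by (subst sum.remove[of _ l]) (auto simp: u_def w_def intro!: sum.cong)
    also have "\<dots> = sqrt (card R) - (card R - 1) / sqrt (card R)"
      using R by simp
    also have "\<dots> = 1 / sqrt (card R)"
      using pos real_div_sqrt[of "card R"] by (simp add: diff_divide_distrib)
    finally show ?thesis using that by (simp add: e_def)
  qed
  have uw0: "(\<Sum>j\<in>UNIV. u R l $ j * w R' l' $ j) = 0" if "l \<in> R" "l' \<in> R'" "R \<inter> R' = {}" for R R' l l'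
    using that by (intro sum.neutral) (auto simp: u_def w_def)
  have delta: "(\<Sum>j\<in>UNIV. (if i = j then 1 else 0) * x $ j) = x $ i" for i and x :: "real ^ 'n"
    by (simp add: if_distrib[of "\<lambda>c. c * _"] cong: if_cong)
  have A0P: "(A0 *v w P i0) $ i = e P $ i" for i
    using uw[OF i0] uw0[OF j0 i0] delta[of i "w P i0"] disj ne
    by (cases "i = i0"; cases "i = j0") (auto simp: matrix_vector_mult_def A0_eq, auto simp: w_def e_def)
  have A0Q: "(A0 *v w Q j0) $ i = e Q $ i" for i
    using uw[OF j0] uw0[OF i0 j0] delta[of i "w Q j0"] disj ne
    by (cases "i = i0"; cases "i = j0") (auto simp: matrix_vector_mult_def A0_eq, auto simp: w_def e_def)
  have A1: "det A1 = sqrt (card P)"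
    using cramer_lemma[of i0 A0 "w P i0"] A0 unfolding A0P A1_def by (simp add: w_def)
  \<comment> \<open>Only column \<open>i0\<close> differs between \<open>A1\<close> and
    \<open>A0\<close>, and entry \<open>i0\<close> of \<open>w Q j0\<close> vanishes.\<close>
  have "(A1 *v w Q j0) $ i = (A0 *v w Q j0) $ i" for i
    unfolding matrix_vector_mult_def using ne
    by (auto simp: A1_def w_def intro!: sum.cong)
  moreover have "?B = (\<chi> i j. if j = j0 then e Q $ i else A1 $ i $ j)"
    using ne disj by (auto simp: vec_eq_iff A1_def A0_eq u_def e_def)
  moreover have "w Q j0 $ j0 = sqrt (card Q)" by (simp add: w_def)
  ultimately show ?thesis
    using cramer_lemma[of j0 A1 "w Q j0"] A1 by (simp add: A0Q mult.commute cong: if_cong)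
qed

text \<open>Each factor on the right is the volume of a regular simplex with \<open>card P\<close>
  (or \<open>card Q\<close>) vertices, scaled by s (or t). The two block-sum equations account for
  \<open>k + 2\<close>.\<close>

lemma measure_flat_frame_coordinates_wellorder:
  fixes P Q :: "'n::{finite,wellorder} set"
  assumes PQ: "P \<union> Q = UNIV" "P \<inter> Q = {}" "P \<noteq> {}" "Q \<noteq> {}" and st: "0 < s" "0 < t"
    and card: "k + 2 = CARD('n)"
  defines "S \<equiv> {x :: (real, 'n) vec. (\<forall>i. 0 \<le> x $ i) \<and> (\<Sum>i\<in>P. x $ i) = s \<and> (\<Sum>i\<in>Q. x $ i) = t}"
  assumes frame: "flat_frame k S p b"
  shows "measure (completion (PiM {..<k} (\<lambda>_. lborel)))
           {x \<in> {..<k} \<rightarrow>\<^sub>E UNIV. p + (\<Sum>i<k. x i *\<^sub>R b i) \<in> S} =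
         sqrt (card P) * (s ^ (card P - 1) / fact (card P - 1)) *
         (sqrt (card Q) * (t ^ (card Q - 1) / fact (card Q - 1)))"
proof -
  obtain i0 j0 where i0: "i0 \<in> P" and j0: "j0 \<in> Q" using PQ by blast
  have ne: "i0 \<noteq> j0" "i0 \<notin> Q" "j0 \<notin> P" using i0 j0 PQ by auto
  have Q_iff: "i \<in> Q \<longleftrightarrow> i \<notin> P" for i using PQ by auto
  define K where "K = - {i0, j0}"
  define I where "I = P - {i0}"
  define J where "J = Q - {j0}"
  have K: "K = I \<union> J" "I \<inter> J = {}" using PQ i0 j0 ne by (auto simp: K_def I_def J_def)
  have P: "P = insert i0 I" "i0 \<notin> I" and Q: "Q = insert j0 J" "j0 \<notin> J"
    using i0 j0 by (auto simp: I_def J_def)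
  have pq: "0 < card P" "0 < card Q" using PQ by (auto simp: card_gt_0_iff)
  define eP :: "(real, 'n) vec" where "eP = (\<chi> i. if i \<in> P then 1 / sqrt (card P) else 0)"
  define eQ :: "(real, 'n) vec" where "eQ = (\<chi> i. if i \<in> Q then 1 / sqrt (card Q) else 0)"
  have dot_e: "eP \<bullet> x = (\<Sum>i\<in>P. x $ i) / sqrt (card P)" "eQ \<bullet> x = (\<Sum>i\<in>Q. x $ i) / sqrt (card Q)" for x
    by (simp_all add: eP_def eQ_def inner_vec_def if_distrib[of "\<lambda>c. c * _"]
        sum.If_cases sum_divide_distrib cong: if_cong)
  have orth_e: "eP \<bullet> eP = 1" "eQ \<bullet> eQ = 1" "eP \<bullet> eQ = 0"
    using pq unfolding dot_e
    by (auto simp: eP_def eQ_def Q_iff)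
  have b_orth: "b i \<bullet> b j = (if i = j then 1 else 0)" if "i < k" "j < k" for i j
    using frame that by (auto simp: flat_frame_def)
  have S_frame: "\<exists>u. x = p + (\<Sum>i<k. u i *\<^sub>R b i)" if "x \<in> S" for x
    using frame that by (auto simp: flat_frame_def)

  \<comment> \<open>The frame directions are orthogonal to both block vectors: V has dimension k and, as S has
    a relatively interior point, lies in the span of the frame, so the two coincide.\<close>
  define V where "V = {x :: (real, 'n) vec. eP \<bullet> x = 0 \<and> eQ \<bullet> x = 0}"
  have V_span: "V \<subseteq> span (b ` {..<k})"
  proof
    fix x assume x: "x \<in> V"
    \<comment> \<open>The barycentre of S: it is constant on each block, and all its entries are at
      least d > 0.\<close>
    define c :: "(real, 'n) vec" where "c = (\<chi> i. if i \<in> P then s / card P else t / card Q)"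
    define d where "d = min (s / card P) (t / card Q)"
    have d: "0 < d" using st pq by (simp add: d_def)
    \<comment> \<open>A step small enough that r times any entry of x stays within d; the summand 1
      covers x = 0.\<close>
    define r where "r = d / (norm x + 1)"
    have nx: "0 < norm x + 1" by (simp add: add_nonneg_pos)
    have r: "0 < r" using d nx by (simp add: r_def)
    have sums: "(\<Sum>i\<in>P. c $ i) = s" "(\<Sum>i\<in>Q. c $ i) = t"
      using pq PQ(3,4) by (simp_all add: c_def Q_iff)
    have x0: "(\<Sum>i\<in>P. x $ i) = 0" "(\<Sum>i\<in>Q. x $ i) = 0"
      using x PQ(3,4) by (simp_all add: V_def dot_e)
    have c_ge: "d \<le> c $ i" for i by (auto simp: c_def d_def)
    have "0 \<le> (c + r *\<^sub>R x) $ i" for i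
    proof -
      have "r * \<bar>x $ i\<bar> \<le> r * (norm x + 1)"
        using r component_le_norm_cart[of x i] by (intro mult_left_mono) auto
      also have "\<dots> = d" using nx by (simp add: r_def)
      finally have "r * \<bar>x $ i\<bar> \<le> c $ i" using c_ge[of i] by linarith
      moreover have "- (r * \<bar>x $ i\<bar>) \<le> r * x $ i"
        using r by (simp add: abs_if mult_less_0_iff not_less)
      ultimately show ?thesis by simp
    qed
    then have "c + r *\<^sub>R x \<in> S"
      using sums x0 by (simp add: S_def sum.distrib flip: sum_distrib_left)
    moreover have "c \<in> S"
      using sums c_ge d by (auto simp: S_def intro: order_trans[of 0 d])
    ultimately obtain u v where uv: "c + r *\<^sub>R x = p + (\<Sum>i<k. u i *\<^sub>R b i)" "c = p + (\<Sum>i<k. v i *\<^sub>R b i)"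
      using S_frame by metis
    have "r *\<^sub>R x = (p + (\<Sum>i<k. u i *\<^sub>R b i)) - (p + (\<Sum>i<k. v i *\<^sub>R b i))"
      using uv by (metis add_diff_cancel_left')
    also have "\<dots> = (\<Sum>i<k. u i *\<^sub>R b i) - (\<Sum>i<k. v i *\<^sub>R b i)" by simp
    also have "\<dots> \<in> span (b ` {..<k})"
      by (intro span_diff span_sum span_scale span_base) auto
    finally have "(1 / r) *\<^sub>R (r *\<^sub>R x) \<in> span (b ` {..<k})" by (rule span_scale)
    then show "x \<in> span (b ` {..<k})" using r by simp
  qed
  have sub: "subspace V"
    by (auto simp: V_def subspace_def inner_right_distrib)
  have "dim {y \<in> UNIV. \<forall>x\<in>span {eP, eQ}. orthogonal x y} + dim (span {eP, eQ}) = dim (UNIV :: ((real, 'n) vec) set)"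
    by (rule dim_subspace_orthogonal_to_vectors) auto
  moreover have "dim {y \<in> UNIV. \<forall>x\<in>span {eP, eQ}. orthogonal x y} \<le> dim V"
    by (intro dim_subset) (auto simp: V_def orthogonal_def span_base)
  moreover have "dim (span {eP, eQ}) \<le> 2"
    using dim_le_card'[of "{eP, eQ}"] card_insert_le_m1[of 2 "{eQ}" eP] by simp
  ultimately have dimV: "k \<le> dim V" using card by simp
  have "dim (span (b ` {..<k})) \<le> k"
    using dim_le_card'[of "b ` {..<k}"] card_image_le[of "{..<k}" b] by simp
  then have V: "V = span (b ` {..<k})"
    using V_span dimV sub by (intro subspace_dim_equal) auto
  have eb: "eP \<bullet> b i = 0" "eQ \<bullet> b i = 0" if "i < k" for i
  proof -
    have "b i \<in> V" unfolding V using that by (auto intro: span_base)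
    then show "eP \<bullet> b i = 0" "eQ \<bullet> b i = 0" by (auto simp: V_def)
  qed

  \<comment> \<open>Orthonormal coordinates adapted to the frame\<close>
  have "card K = k" using card ne by (simp add: K_def Compl_eq_Diff_UNIV card_Diff_subset)
  then obtain h where h: "bij_betw h K {..<k}"
    using finite_same_card_bij[of K "{..<k}"] by auto
  have hk: "h l < k" if "l \<in> K" for l using bij_betwE[OF h] that by auto
  have h_inj: "h l = h l' \<longleftrightarrow> l = l'" if "l \<in> K" "l' \<in> K" for l l'
    using h that by (auto simp: bij_betw_def inj_on_def)
  \<comment> \<open>The rows of M are the frame vectors, placed at the indices in K by h, and the
    two block vectors at \<open>i0\<close> and \<open>j0\<close>. F is multiplication by the
    transpose of M, hence its inverse.\<close>
  define M :: "((real, 'n) vec, 'n) vec" where "M = (\<chi> l. if l = i0 then eP else if l = j0 then eQ else b (h l))"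
  define F where "F w = (\<Sum>l\<in>UNIV. w $ l *\<^sub>R M $ l)" for w :: "(real, 'n) vec"
  have M: "M $ l \<bullet> M $ l' = (if l = l' then 1 else 0)" for l l'
    using hk[of l] hk[of l'] h_inj[of l l'] ne(1)
    by (auto simp: M_def K_def orth_e eb b_orth inner_commute)
  have MF: "M *v F w = w" for w
  proof -
    have "(M *v F w) $ l = (\<Sum>l'\<in>UNIV. w $ l' * (M $ l \<bullet> M $ l'))" for l
      by (simp add: matrix_vector_mul_component F_def inner_sum_right)
    then show ?thesis by (simp add: vec_eq_iff M if_distrib[of "\<lambda>c. _ * c"] cong: if_cong)
  qed
  have F_eq: "F w = (\<Sum>l\<in>K. w $ l *\<^sub>R b (h l)) + w $ i0 *\<^sub>R eP + w $ j0 *\<^sub>R eQ" for w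
  proof -
    have UN: "UNIV = insert i0 (insert j0 K)" by (auto simp: K_def)
    show ?thesis
      unfolding F_def UN using ne(1)
      by (simp add: M_def K_def add_ac)
  qed
  have orthM: "orthogonal_transformation ((*v) M)"
    unfolding orthogonal_transformation_matrix
    by (simp add: orthogonal_matrix_orthonormal_rows row_def M norm_eq_1 orthogonal_def)

  \<comment> \<open>E thickens S by unit segments in the two normal directions, so its full-dimensional measure is
    the volume of S.  It is a rigid image of C and an affine image of C', a product of corner
    simplices and two unit intervals.\<close>
  define E where "E = {x + y *\<^sub>R eP + z *\<^sub>R eQ | x y z. x \<in> S \<and> y \<in> {0..1} \<and> z \<in> {0..1::real}}"
  define A where "A = {x \<in> {..<k} \<rightarrow>\<^sub>E UNIV. p + (\<Sum>i<k. x i *\<^sub>R b i) \<in> S}"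
  define B where "B = {x \<in> K \<rightarrow>\<^sub>E UNIV. p + (\<Sum>l\<in>K. x l *\<^sub>R b (h l)) \<in> S}"
  define C where "C = {w :: (real, 'n) vec. (\<lambda>l\<in>K. w $ l) \<in> B \<and> w $ i0 \<in> {0..1} \<and> w $ j0 \<in> {0..1}}"
  have C_iff: "w \<in> C \<longleftrightarrow> p + (\<Sum>l\<in>K. w $ l *\<^sub>R b (h l)) \<in> S \<and> w $ i0 \<in> {0..1} \<and> w $ j0 \<in> {0..1}" for w
    by (simp add: C_def B_def)
  have E_C: "E = (\<lambda>w. p + F w) ` C"
  proof (intro equalityI subsetI)
    fix e assume "e \<in> E"
    then obtain x y z where e: "e = x + y *\<^sub>R eP + z *\<^sub>R eQ" "x \<in> S" "y \<in> {0..1}" "z \<in> {0..1}"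
      by (auto simp: E_def)
    obtain u where u: "x = p + (\<Sum>i<k. u i *\<^sub>R b i)" using S_frame[OF e(2)] by blast
    define w :: "(real, 'n) vec" where "w = (\<chi> l. if l = i0 then y else if l = j0 then z else u (h l))"
    have w: "w $ l = u (h l)" if "l \<in> K" for l
      using ne that by (auto simp: w_def K_def)
    have w0: "w $ i0 = y" "w $ j0 = z" using ne by (auto simp: w_def)
    have "(\<Sum>l\<in>K. w $ l *\<^sub>R b (h l)) = (\<Sum>i<k. u i *\<^sub>R b i)"
      by (subst sum.reindex_bij_betw[OF h, symmetric]) (simp add: w)
    then have "e = p + F w" "w \<in> C"
      using e u by (simp_all add: F_eq C_iff w0 add_ac)
    then show "e \<in> (\<lambda>w. p + F w) ` C" by blast
  next
    fix e assume "e \<in> (\<lambda>w. p + F w) ` C"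
    then show "e \<in> E" by (force simp: F_eq C_iff E_def add_ac)
  qed
  have C_E: "C = (*v) M ` (\<lambda>x. x - p) ` E"
    by (simp add: E_C image_comp o_def MF)

  \<comment> \<open>Affine coordinates from the entries outside i0 and j0\<close>
  define B' where "B' = {x \<in> space (PiM K (\<lambda>_. lborel)).
      (\<forall>l\<in>K. 0 \<le> x l) \<and> sum x I \<le> s \<and> sum x J \<le> t}"
  define C' where "C' = {w :: (real, 'n) vec. (\<lambda>l\<in>K. w $ l) \<in> B' \<and> w $ i0 \<in> {0..1} \<and> w $ j0 \<in> {0..1}}"
  have C'_iff: "w \<in> C' \<longleftrightarrow> (\<forall>l\<in>K. 0 \<le> w $ l) \<and> (\<Sum>l\<in>I. w $ l) \<le> s \<and> (\<Sum>l\<in>J. w $ l) \<le> t \<and>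
      w $ i0 \<in> {0..1} \<and> w $ j0 \<in> {0..1}" for w
    using K by (simp add: C'_def B'_def space_PiM)
  then have C'_eq: "C' = {w. (\<forall>l\<in>K. 0 \<le> w $ l) \<and> (\<Sum>l\<in>I. w $ l) \<le> s \<and> (\<Sum>l\<in>J. w $ l) \<le> t \<and>
      w $ i0 \<in> {0..1} \<and> w $ j0 \<in> {0..1}}" by blast
  have compC': "compact C'"
  proof -
    have "closed C'"
      unfolding C'_eq Ball_def atLeastAtMost_iff
      by (intro closed_Collect_conj closed_Collect_all closed_Collect_imp closed_Collect_le
          continuous_intros open_Collect_const)
    moreover have "C' \<subseteq> cbox 0 (\<chi> i. max 1 (max s t))"
    proof
      fix w assume w: "w \<in> C'"
      have "w $ i \<le> max 1 (max s t)" "0 \<le> w $ i" for i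
      proof -
        have "w $ i \<le> s" if "i \<in> I"
          using member_le_sum[OF that, of "($) w"] w K by (auto simp: C'_iff)
        moreover have "w $ i \<le> t" if "i \<in> J"
          using member_le_sum[OF that, of "($) w"] w K by (auto simp: C'_iff)
        moreover have "i \<in> I \<or> i \<in> J \<or> i = i0 \<or> i = j0" using K(1) by (auto simp: K_def)
        ultimately show "w $ i \<le> max 1 (max s t)" "0 \<le> w $ i"
          using w K by (auto simp: C'_iff)
      qed
      then show "w \<in> cbox 0 (\<chi> i. max 1 (max s t))" by (simp add: mem_box_cart)
    qed
    then have "bounded C'" using bounded_cbox bounded_subset by blast
    ultimately show ?thesis by (simp add: compact_eq_bounded_closed)
  qed

  define T :: "((real, 'n) vec, 'n) vec"
    where "T = (\<chi> i j. if j = i0 then if i \<in> P then 1 / sqrt (card P) else 0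
                      else if j = j0 then if i \<in> Q then 1 / sqrt (card Q) else 0
                      else if i = j then 1
                      else if i = i0 \<and> j \<in> P \<or> i = j0 \<and> j \<in> Q then - 1 else 0)"
  define x0 :: "(real, 'n) vec" where "x0 = s *\<^sub>R axis i0 1 + t *\<^sub>R axis j0 1"
  \<comment> \<open>The entries at \<open>i0\<close> and \<open>j0\<close> of a point of S are
    determined by the block sums, so X refills them with the remaining mass. The slots
    \<open>w $ i0\<close> and \<open>w $ j0\<close> become free and carry the two
    thicknesses.\<close>
  define X where "X w = (\<chi> l. if l = i0 then s - (\<Sum>l\<in>I. w $ l) else if l = j0 then t - (\<Sum>l\<in>J. w $ l) else w $ l)"
    for w :: "(real, 'n) vec"
  have X: "x0 + T *v w = X w + w $ i0 *\<^sub>R eP + w $ j0 *\<^sub>R eQ" for w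
  proof -
    have UN: "UNIV = insert i0 (insert j0 (I \<union> J))" unfolding K(1)[symmetric] by (auto simp: K_def)
    have nIJ: "i0 \<notin> I \<union> J" "j0 \<notin> I \<union> J" unfolding K(1)[symmetric] by (auto simp: K_def)
    have I_mem: "j \<in> P" "j \<notin> Q" "j \<noteq> i0" "j \<noteq> j0" if "j \<in> I" for j
      using that ne Q_iff by (auto simp: I_def)
    have J_mem: "j \<in> Q" "j \<notin> P" "j \<noteq> i0" "j \<noteq> j0" if "j \<in> J" for j
      using that ne Q_iff by (auto simp: J_def)
    have T0: "T $ i $ i0 = eP $ i" "T $ i $ j0 = eQ $ i" for i
      using ne by (auto simp: T_def eP_def eQ_def)
    have sum_I: "(\<Sum>j\<in>I. T $ i $ j * w $ j) =
        (if i = i0 then - (\<Sum>j\<in>I. w $ j) else if i \<in> I then w $ i else 0)" for i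
    proof -
      have "(\<Sum>j\<in>I. T $ i $ j * w $ j) =
          (\<Sum>j\<in>I. if i = i0 then - w $ j else if i = j then w $ j else 0)"
        using I_mem by (intro sum.cong) (auto simp: T_def)
      then show ?thesis by (auto simp: sum_negf)
    qed
    have sum_J: "(\<Sum>j\<in>J. T $ i $ j * w $ j) =
        (if i = j0 then - (\<Sum>j\<in>J. w $ j) else if i \<in> J then w $ i else 0)" for i
    proof -
      have "(\<Sum>j\<in>J. T $ i $ j * w $ j) =
          (\<Sum>j\<in>J. if i = j0 then - w $ j else if i = j then w $ j else 0)"
        using J_mem by (intro sum.cong) (auto simp: T_def)
      then show ?thesis by (auto simp: sum_negf)
    qed
    have "(T *v w) $ i = T $ i $ i0 * w $ i0 + (T $ i $ j0 * w $ j0 +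
        ((\<Sum>j\<in>I. T $ i $ j * w $ j) + (\<Sum>j\<in>J. T $ i $ j * w $ j)))" for i
      unfolding matrix_vector_mult_def UN using nIJ ne(1) K(2) by (simp add: sum.union_disjoint)
    then have Tw: "(T *v w) $ i = eP $ i * w $ i0 + (eQ $ i * w $ j0 +
        ((if i = i0 then - (\<Sum>j\<in>I. w $ j) else if i \<in> I then w $ i else 0) +
         (if i = j0 then - (\<Sum>j\<in>J. w $ j) else if i \<in> J then w $ i else 0)))" for i
      unfolding T0 sum_I sum_J .
    have "(x0 + T *v w) $ i = (X w + w $ i0 *\<^sub>R eP + w $ j0 *\<^sub>R eQ) $ i" for i
    proof -
      consider "i = i0" | "i = j0" | "i \<in> I" | "i \<in> J" using UN by auto
      then show ?thesis
        using nIJ ne(1) I_mem[of i] J_mem[of i]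
        by cases (auto simp: Tw x0_def X_def axis_def)
    qed
    then show ?thesis by (simp add: vec_eq_iff)
  qed
  have X_S: "X w \<in> S \<longleftrightarrow> (\<forall>l\<in>K. 0 \<le> w $ l) \<and> (\<Sum>l\<in>I. w $ l) \<le> s \<and> (\<Sum>l\<in>J. w $ l) \<le> t" for w
  proof -
    have "(\<Sum>l\<in>I. X w $ l) = (\<Sum>l\<in>I. w $ l)" "(\<Sum>l\<in>J. X w $ l) = (\<Sum>l\<in>J. w $ l)"
      using K by (auto simp: X_def K_def intro!: sum.cong)
    moreover have "(\<forall>l. 0 \<le> X w $ l) \<longleftrightarrow> 0 \<le> X w $ i0 \<and> 0 \<le> X w $ j0 \<and> (\<forall>l\<in>K. 0 \<le> X w $ l)"
      by (auto simp: K_def)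
    moreover have "(\<forall>l\<in>K. 0 \<le> X w $ l) \<longleftrightarrow> (\<forall>l\<in>K. 0 \<le> w $ l)"
      by (auto simp: K_def X_def)
    moreover have "X w $ i0 = s - (\<Sum>l\<in>I. w $ l)" "X w $ j0 = t - (\<Sum>l\<in>J. w $ l)"
      using ne by (auto simp: X_def)
    ultimately show ?thesis using P Q by (auto simp: S_def)
  qed
  have E_C': "E = (+) x0 ` (*v) T ` C'"
  proof (intro equalityI subsetI)
    fix e assume "e \<in> E"
    then obtain x y z where e: "e = x + y *\<^sub>R eP + z *\<^sub>R eQ" "x \<in> S" "y \<in> {0..1}" "z \<in> {0..1}"
      by (auto simp: E_def)
    define w :: "(real, 'n) vec" where "w = (\<chi> l. if l = i0 then y else if l = j0 then z else x $ l)"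
    have w0: "w $ i0 = y" "w $ j0 = z" using ne by (auto simp: w_def)
    have "(\<Sum>l\<in>I. w $ l) = (\<Sum>l\<in>I. x $ l)" "(\<Sum>l\<in>J. w $ l) = (\<Sum>l\<in>J. x $ l)"
      using K by (auto simp: w_def K_def intro!: sum.cong)
    then have "X w = x"
      using e(2) P Q by (auto simp: X_def S_def vec_eq_iff w_def)
    then have "e = x0 + T *v w" "w \<in> C'"
      using e X_S[of w] by (simp_all add: X w0 C'_iff)
    then show "e \<in> (+) x0 ` (*v) T ` C'" by blast
  next
    fix e assume "e \<in> (+) x0 ` (*v) T ` C'"
    then obtain w where w: "e = x0 + T *v w" "w \<in> C'" by blast
    then have "X w \<in> S" by (simp add: X_S C'_iff)
    then show "e \<in> E" using w unfolding X E_def C'_iff by blast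
  qed

  \<comment> \<open>Measurability and the comparison of measures\<close>
  have compE: "compact E"
    unfolding E_C' by (intro compact_translation compact_continuous_image compC' continuous_intros)
  \<comment> \<open>Compactness travels from \<open>C'\<close> to \<open>E\<close> and from there to
    \<open>C\<close>, which makes all three sets measurable.\<close>
  have compC: "compact C"
    unfolding C_E by (intro compact_continuous_image continuous_intros compE)
  have "closed S"
    unfolding S_def by (intro closed_Collect_conj closed_Collect_all closed_Collect_le closed_Collect_eq continuous_intros)
  then have S_sets: "S \<in> sets borel" by (rule borel_closed)
  have flat_sets: "{x \<in> N \<rightarrow>\<^sub>E UNIV. p + (\<Sum>i\<in>N. x i *\<^sub>R v i) \<in> S} \<in> sets (PiM N (\<lambda>_. lborel))"
    for N :: "'i set" and v
  proof -
    have "(\<lambda>x. p + (\<Sum>i\<in>N. x i *\<^sub>R v i)) \<in> borel_measurable (PiM N (\<lambda>_. lborel))"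
      by (intro borel_measurable_add borel_measurable_const borel_measurable_sum borel_measurable_scaleR)
        (simp add: measurable_component_singleton flip: measurable_lborel2)
    from measurable_sets[OF this S_sets] show ?thesis
      by (simp add: vimage_def Int_def conj_commute space_PiM)
  qed
  have A_sets: "A \<in> sets (PiM {..<k} (\<lambda>_. lborel))"
    unfolding A_def by (rule flat_sets)
  have B_sets: "B \<in> sets (PiM K (\<lambda>_. lborel))"
    unfolding B_def by (rule flat_sets)
  have B'_sets: "B' \<in> sets (PiM K (\<lambda>_. lborel))"
    unfolding B'_def K(1) by (rule sets_corner_simplices[OF _ _ K(2)]) simp_all
  interpret product_sigma_finite "\<lambda>_::nat. lborel :: real measure" by standard
  have "measure (completion (PiM {..<k} (\<lambda>_. lborel))) A = measure (PiM {..<k} (\<lambda>_. lborel)) A"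
    using A_sets by simp
  also have "\<dots> = measure (PiM K (\<lambda>_. lborel)) B"
  proof -
    have "A = {x \<in> space (PiM {..<k} (\<lambda>_. lborel)). (\<lambda>l\<in>K. x (h l)) \<in> B}"
      by (simp add: A_def B_def space_PiM sum.reindex_bij_betw[OF h, of "\<lambda>i. _ i *\<^sub>R b i"])
    then show ?thesis
      using emeasure_PiM_reindex[OF h _ B_sets] by (simp add: measure_def)
  qed
  also have "\<dots> = measure lebesgue C"
    using measure_lborel_vec_cylinder[OF ne(1), of B] B_sets compC
    by (simp add: C_def K_def borel_compact)
  also have "\<dots> = measure lebesgue E"
    unfolding C_E using compact_translation_subtract[OF compE, of p]
    by (simp add: measure_orthogonal_image[OF orthM] lmeasurable_compact measure_translation_subtract)
  also have "\<dots> = sqrt (card P) * sqrt (card Q) * measure lebesgue C'"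
    unfolding E_C' using compC' det_block_edge_matrix[OF i0 j0 PQ(2)]
    by (simp add: measure_translation measure_linear_image lmeasurable_compact T_def abs_mult)
  also have "measure lebesgue C' = measure (PiM K (\<lambda>_. lborel)) B'"
    using measure_lborel_vec_cylinder[OF ne(1), of B'] B'_sets compC'
    by (simp add: C'_def K_def borel_compact)
  also have "\<dots> = s ^ card I / fact (card I) * (t ^ card J / fact (card J))"
    using measure_corner_simplices[OF _ _ K(2), of s t] st by (simp add: B'_def K)
  finally show ?thesis
    using i0 j0 by (simp add: A_def I_def J_def)
qed

text \<open>The library states the linear change of variables only for well-ordered index types.  The
  type below is a well-ordered copy of a finite type; frames are transported to it.\<close>

typedef 'a idx = "{..<CARD('a::finite)}"
  by (rule exI[of _ 0]) simp

instantiation idx :: (finite) linorder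
begin
definition "i \<le> j \<longleftrightarrow> Rep_idx i \<le> Rep_idx j"
definition "i < j \<longleftrightarrow> Rep_idx i < Rep_idx j"
instance
  by standard (auto simp: less_eq_idx_def less_idx_def Rep_idx_inject)
end

instance idx :: (finite) finite
  by standard (simp add: type_definition.univ[OF type_definition_idx])

instance idx :: (finite) wellorder
proof
  fix P :: "'a idx \<Rightarrow> bool" and i
  assume "\<And>i. (\<And>j. j < i \<Longrightarrow> P j) \<Longrightarrow> P i"
  then show "P i"
    unfolding less_idx_def by (rule measure_induct_rule[of Rep_idx])
qed

lemma card_idx: "CARD('a idx) = CARD('a::finite)"
  by (simp add: type_definition.card[OF type_definition_idx])

lemma measure_flat_frame_coordinates:
  fixes P Q :: "'n::finite set"
  assumes PQ: "P \<union> Q = UNIV" "P \<inter> Q = {}" "P \<noteq> {}" "Q \<noteq> {}" and st: "0 < s" "0 < t"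
    and card: "k + 2 = CARD('n)"
  defines "S \<equiv> {x :: real ^ 'n. (\<forall>i. 0 \<le> x $ i) \<and> (\<Sum>i\<in>P. x $ i) = s \<and> (\<Sum>i\<in>Q. x $ i) = t}"
  assumes frame: "flat_frame k S p b"
  shows "measure (completion (PiM {..<k} (\<lambda>_. lborel)))
           {x \<in> {..<k} \<rightarrow>\<^sub>E UNIV. p + (\<Sum>i<k. x i *\<^sub>R b i) \<in> S} =
         sqrt (card P) * (s ^ (card P - 1) / fact (card P - 1)) *
         (sqrt (card Q) * (t ^ (card Q - 1) / fact (card Q - 1)))"
proof -
  obtain g :: "'n idx \<Rightarrow> 'n" where g: "bij g"
    using finite_same_card_bij[of "UNIV :: 'n idx set" "UNIV :: 'n set"] by (auto simp: card_idx)
  \<comment> \<open>A linear isometry that preserves block sums and nonnegativity, so it takes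
    frames of S to frames of \<open>S'\<close>.\<close>
  define \<rho> where "\<rho> x = (\<chi> l. x $ g l)" for x :: "real ^ 'n"
  define P' where "P' = g -` P"
  define Q' where "Q' = g -` Q"
  define S' where "S' = {x :: (real, 'n idx) vec. (\<forall>i. 0 \<le> x $ i) \<and> (\<Sum>i\<in>P'. x $ i) = s \<and> (\<Sum>i\<in>Q'. x $ i) = t}"
  have bij: "bij_betw g (g -` R) R" for R
    using g by (metis bij_betw_def bij_def inj_on_subset subset_UNIV surj_image_vimage_eq)
  have \<rho>_sum: "(\<Sum>i\<in>g -` R. \<rho> x $ i) = (\<Sum>i\<in>R. x $ i)" for R x
    using sum.reindex_bij_betw[OF bij[of R], of "\<lambda>i. x $ i"] by (simp add: \<rho>_def)
  have \<rho>_all: "(\<forall>i. 0 \<le> \<rho> x $ i) \<longleftrightarrow> (\<forall>i. 0 \<le> x $ i)" for x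
    using bij_is_surj[OF g] by (auto simp: \<rho>_def) (metis surjD)
  have \<rho>_S: "\<rho> x \<in> S' \<longleftrightarrow> x \<in> S" for x
    by (simp add: S'_def S_def P'_def Q'_def \<rho>_sum \<rho>_all)
  have \<rho>_inner: "\<rho> x \<bullet> \<rho> y = x \<bullet> y" for x y
    using sum.reindex_bij_betw[OF g, of "\<lambda>i. x $ i * y $ i"] by (simp add: \<rho>_def inner_vec_def)
  have \<rho>_surj: "\<exists>x. y = \<rho> x" for y
    using g by (intro exI[of _ "\<chi> i. y $ inv g i"]) (simp add: \<rho>_def vec_eq_iff bij_is_inj)
  have \<rho>_flat: "\<rho> p + (\<Sum>i<k. u i *\<^sub>R \<rho> (b i)) = \<rho> (p + (\<Sum>i<k. u i *\<^sub>R b i))" for u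
    by (simp add: \<rho>_def vec_eq_iff)
  have "flat_frame k S' (\<rho> p) (\<rho> \<circ> b)"
    unfolding flat_frame_def
  proof (intro conjI subsetI)
    show "\<forall>i<k. \<forall>j<k. (\<rho> \<circ> b) i \<bullet> (\<rho> \<circ> b) j = (if i = j then 1 else 0)"
      using frame by (simp add: \<rho>_inner flat_frame_def)
    fix y assume "y \<in> S'"
    then obtain x where x: "y = \<rho> x" "x \<in> S" using \<rho>_surj[of y] \<rho>_S by blast
    then obtain u where "x = p + (\<Sum>i<k. u i *\<^sub>R b i)" using frame by (auto simp: flat_frame_def)
    then show "y \<in> {\<rho> p + (\<Sum>i<k. u i *\<^sub>R (\<rho> \<circ> b) i) |u. True}"
      using x by (auto simp: \<rho>_flat)
  qed
  moreover have "card P' = card P" "card Q' = card Q"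
    using bij_betw_same_card[OF bij] by (simp_all add: P'_def Q'_def)
  moreover have "P' \<noteq> {}" "Q' \<noteq> {}"
    using PQ(3,4) bij_betw_imp_surj_on[OF bij] unfolding P'_def Q'_def by (metis image_empty)+
  moreover have "P' \<union> Q' = UNIV" "P' \<inter> Q' = {}"
    using PQ(1,2) by (auto simp: P'_def Q'_def)
  ultimately show ?thesis
    using measure_flat_frame_coordinates_wellorder[of P' Q' s t k "\<rho> p" "\<rho> \<circ> b"] st card
    by (simp add: \<rho>_flat \<rho>_S card_idx flip: S'_def)
qed

text \<open>Once some frame exists, \<open>SOME\<close> returns a genuine frame, to which the
  formula for arbitrary frames applies. Existence follows from the affine dimension of two
  intersecting hyperplanes.\<close>

lemma Vol_simplex_product:
  fixes P Q :: "'n::finite set"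
  assumes PQ: "P \<union> Q = UNIV" "P \<inter> Q = {}" "P \<noteq> {}" "Q \<noteq> {}" and st: "0 < s" "0 < t"
    and card: "k + 2 = CARD('n)"
  defines "S \<equiv> {x :: real ^ 'n. (\<forall>i. 0 \<le> x $ i) \<and> (\<Sum>i\<in>P. x $ i) = s \<and> (\<Sum>i\<in>Q. x $ i) = t}"
  shows "Vol k S = sqrt (card P) * (s ^ (card P - 1) / fact (card P - 1)) *
         (sqrt (card Q) * (t ^ (card Q - 1) / fact (card Q - 1)))"
proof -
  define v :: "'n set \<Rightarrow> real ^ 'n" where "v R = (\<chi> i. if i \<in> R then 1 else 0)" for R
  have v: "v R \<bullet> x = (\<Sum>i\<in>R. x $ i)" for R x
    by (simp add: v_def inner_vec_def if_distrib[of "\<lambda>c. c * _"] sum.If_cases cong: if_cong)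
  \<comment> \<open>A point on the hyperplane of P whose sum over Q is t + 1: the second hyperplane
    does not contain the first, so it lowers the dimension once more.\<close>
  define z :: "real ^ 'n" where "z = (\<chi> i. if i \<in> P then s / card P else (t + 1) / card Q)"
  have pq: "0 < card P" "0 < card Q" using PQ by (auto simp: card_gt_0_iff)
  have Q_iff: "i \<in> Q \<longleftrightarrow> i \<notin> P" for i using PQ by auto
  have "v P \<noteq> 0" using PQ(3) by (auto simp: v_def vec_eq_iff)
  then have dimP: "aff_dim {x. v P \<bullet> x = s} = int CARD('n) - 1"
    by (simp add: aff_dim_hyperplane)
  have "z \<in> {x. v P \<bullet> x = s}" "z \<notin> {x. v Q \<bullet> x = t}"
    using pq PQ(3,4) by (simp_all add: v z_def Q_iff)
  then have "aff_dim ({x. v P \<bullet> x = s} \<inter> {x. v Q \<bullet> x = t}) \<le> aff_dim {x. v P \<bullet> x = s} - 1"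
    using aff_dim_affine_Int_hyperplane[OF affine_hyperplane[of "v P" s], of "v Q" t]
      dimP card
    by (auto split: if_splits)
  moreover have "aff_dim S \<le> aff_dim ({x. v P \<bullet> x = s} \<inter> {x. v Q \<bullet> x = t})"
    by (rule aff_dim_subset) (auto simp: S_def v)
  ultimately have "aff_dim S \<le> int k" using card dimP by simp
  then have "\<exists>p b. flat_frame k S p b"
    using card by (intro flat_frame_exists) auto
  then have "\<exists>pb. case pb of (p, b) \<Rightarrow> flat_frame k S p b" by auto
  then have "case (SOME (p, b). flat_frame k S p b) of (p, b) \<Rightarrow> flat_frame k S p b"
    by (rule someI_ex)
  moreover obtain p b where pb: "(SOME (p, b). flat_frame k S p b) = (p, b)" by fastforce
  ultimately have "flat_frame k S p b" by simp
  then show ?thesis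
    using measure_flat_frame_coordinates[OF PQ st card, folded S_def]
    by (simp only: Vol_def pb Let_def prod.case)
qed

section \<open>Strict log-concavity\<close>

text \<open>The trapezoidal rule overestimates the integral of the convex function 1/t over
  [x, x+1]. For strictness, the gap h increases strictly from x to x + 1, where the non-strict bound
  \<open>ln_inverse_approx_le\<close> still gives a value at most 0.\<close>

lemma ln_Suc_diff_less:
  fixes x :: real
  assumes "0 < x"
  shows "ln (x + 1) - ln x < (1 / x + 1 / (x + 1)) / 2"
proof -
  define h where "h y = ln (y + 1) - ln y - (1 / y + 1 / (y + 1)) / 2" for y :: real
  have "h x < h (x + 1)"
  proof (rule DERIV_pos_imp_increasing[of x "x + 1" h])
    show "\<exists>d. (h has_real_derivative d) (at y) \<and> 0 < d" if "x \<le> y" "y \<le> x + 1" for y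
    proof -
      have y: "0 < y" using assms that by simp
      then have deriv: "(h has_real_derivative 1 / (y + 1) - 1 / y + (1 / y\<^sup>2 + 1 / (y + 1)\<^sup>2) / 2) (at y)"
        unfolding h_def by (auto intro!: derivative_eq_intros simp: power2_eq_square diff_divide_distrib)
      have "1 / y - 1 / (y + 1) = 1 / y * (1 / (y + 1))"
        using y by (simp add: field_simps)
      \<comment> \<open>With u = 1/y and v = 1/(y+1) the relation u - v = u v turns the derivative
        of h into half a square.\<close>
      moreover have "v - u + (u\<^sup>2 + v\<^sup>2) / 2 = (u - v)\<^sup>2 / 2" if "u - v = u * v" for u v :: real
        by (simp add: power2_diff mult.assoc that[symmetric] diff_divide_distrib add_divide_distrib)
      ultimately have eq: "1 / (y + 1) - 1 / y + (1 / y\<^sup>2 + 1 / (y + 1)\<^sup>2) / 2 = (1 / y - 1 / (y + 1))\<^sup>2 / 2"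
        unfolding power_one_over[symmetric] by blast
      have "1 / y \<noteq> 1 / (y + 1)" using y by (simp add: field_simps)
      then have "0 < 1 / (y + 1) - 1 / y + (1 / y\<^sup>2 + 1 / (y + 1)\<^sup>2) / 2"
        unfolding eq by simp
      with deriv show ?thesis by blast
    qed
  qed simp
  also have "h (x + 1) \<le> 0"
    using ln_inverse_approx_le[of "x + 1" 1] assms by (simp add: h_def inverse_eq_divide)
  finally show ?thesis by (simp add: h_def)
qed

text \<open>The factor x + 1/2 is the one for which (x + 1/2)(1/x - 1/(x+1)) is exactly the mean of
  1/x and 1/(x+1). The derivative is therefore the integral of 1/t minus its trapezoidal
  value.\<close>

lemma log_ratio_decreasing:
  fixes x y :: real
  assumes "0 < x" "x < y"
  shows "(y + 1 / 2) * (ln (y + 1) - ln y) < (x + 1 / 2) * (ln (x + 1) - ln x)"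
proof (rule DERIV_neg_imp_decreasing[OF assms(2)])
  fix z assume "x \<le> z" "z \<le> y"
  then have z: "0 < z" using assms by simp
  let ?d = "(ln (z + 1) - ln z) + (z + 1 / 2) * (1 / (z + 1) - 1 / z)"
  have "((\<lambda>z. (z + 1 / 2) * (ln (z + 1) - ln z)) has_real_derivative ?d) (at z)"
    using z by (auto intro!: derivative_eq_intros)
  moreover have "(z + 1 / 2) * (1 / (z + 1) - 1 / z) = - ((1 / z + 1 / (z + 1)) / 2)"
    using z by (simp add: field_simps)
  then have "?d < 0" using ln_Suc_diff_less[OF z] by simp
  ultimately show "\<exists>d. ((\<lambda>z. (z + 1 / 2) * (ln (z + 1) - ln z)) has_real_derivative d) (at z) \<and> d < 0"
    by blast
qed

text \<open>The function F of the overview: the volume of the standard simplex with p vertices,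
  dilated by p.\<close>

definition simplex_factor :: "nat \<Rightarrow> real" where
  "simplex_factor p = sqrt p * real p ^ (p - 1) / fact (p - 1)"

lemma simplex_factor_pos: "0 < p \<Longrightarrow> 0 < simplex_factor p"
  by (simp add: simplex_factor_def)

lemma ln_simplex_factor_Suc:
  assumes "0 < p"
  shows "ln (simplex_factor (Suc p)) =
    ln (simplex_factor p) + (real p + 1 / 2) * (ln (real p + 1) - ln (real p))"
proof -
  have f: "(fact p :: real) = real p * fact (p - 1)" using assms by (rule fact_reduce)
  have L: "ln (simplex_factor q) = (real q - 1 / 2) * ln q - ln (fact (q - 1))" if "0 < q" for q
    using that by (simp add: simplex_factor_def ln_mult ln_div ln_sqrt ln_realpow of_nat_diff algebra_simps)
  show ?thesis
    using assms by (simp add: L f ln_mult algebra_simps del: fact_Suc)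
qed

lemma ln_simplex_factor_sum:
  assumes "0 < p"
  shows "ln (simplex_factor (p + q)) = ln (simplex_factor p) +
    (\<Sum>i<q. (real (p + i) + 1 / 2) * (ln (real (p + i) + 1) - ln (real (p + i))))"
  using assms by (induction q) (simp_all add: ln_simplex_factor_Suc)

text \<open>With r = q - 1, both the way from F(p) to F(p + r) and the way from F(1) = 1 to F(q)
  take r steps. Each logarithmic increment of the first is smaller because p > 1, and q \<ge> 2
  ensures at least one step.\<close>

lemma simplex_factor_mult_less:
  assumes "2 \<le> p" "2 \<le> q"
  shows "simplex_factor (p + q - 1) < simplex_factor p * simplex_factor q"
proof -
  define g where "g x = (x + 1 / 2) * (ln (x + 1) - ln x)" for x :: real
  obtain r where r: "q = Suc r" "0 < r" using assms(2) by (cases q) auto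
  have "(\<Sum>i<r. g (real (p + i))) < (\<Sum>i<r. g (real (1 + i)))"
    using assms(1) r(2) unfolding g_def
    by (intro sum_strict_mono log_ratio_decreasing) auto
  moreover have "ln (simplex_factor 1) = 0" by (simp add: simplex_factor_def)
  ultimately have "ln (simplex_factor (p + r)) < ln (simplex_factor p) + ln (simplex_factor (1 + r))"
    using assms(1) by (simp only: ln_simplex_factor_sum zero_less_one) (simp add: g_def)
  also have "\<dots> = ln (simplex_factor p * simplex_factor q)"
    using assms r simplex_factor_pos[of p] simplex_factor_pos[of q] by (simp add: ln_mult)
  finally show ?thesis
    using assms r simplex_factor_pos[of p] simplex_factor_pos[of q] simplex_factor_pos[of "p + r"]
    by simp
qed

text \<open>Splitting n - 1/2 as (n - 1) + 1/2 lets the half power absorb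
  \<open>sqrt (n + 1)\<close> and leave \<open>sqrt n\<close>. As F(1) = 1, this is the slice volume
  for blocks of sizes 1 and n.\<close>

lemma V_min_eq:
  assumes "1 \<le> n"
  shows "V_min n = simplex_factor n / (real n + 1) ^ (n - 1)"
proof -
  have "(real n / (real n + 1)) powr (real n - 1 / 2) =
      (real n / (real n + 1)) powr real (n - 1) * (real n / (real n + 1)) powr (1 / 2)"
    using assms by (simp add: of_nat_diff flip: powr_add)
  also have "\<dots> = (real n / (real n + 1)) ^ (n - 1) * sqrt (real n / (real n + 1))"
    using assms by (subst powr_realpow) (simp_all add: powr_half_sqrt)
  finally show ?thesis
    by (simp add: V_min_def simplex_factor_def real_sqrt_divide power_divide)
qed

lemma slice_volume_eq:
  assumes "0 < p" "0 < q" "p + q = n + 1"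
  shows "sqrt p * ((real p / (real n + 1)) ^ (p - 1) / fact (p - 1)) *
         (sqrt q * ((real q / (real n + 1)) ^ (q - 1) / fact (q - 1))) =
         simplex_factor p * simplex_factor q / (real n + 1) ^ (n - 1)"
proof -
  have "n - 1 = (p - 1) + (q - 1)" using assms by simp
  then show ?thesis by (simp add: simplex_factor_def power_divide power_add)
qed

section \<open>Two-valued normal vectors\<close>

lemma std_simplex_eq: "(std_simplex :: (real ^ 'n) set) = {x. (\<forall>i. 0 \<le> x $ i) \<and> (\<Sum>i\<in>UNIV. x $ i) = 1}"
proof -
  have inj: "inj (\<lambda>i::'n. axis i (1::real))" by (simp add: inj_on_def axis_eq_axis)
  have vec: "(\<Sum>i\<in>UNIV. f i *\<^sub>R axis i 1) = (\<chi> i. f i)" for f :: "'n \<Rightarrow> real"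
    by (simp add: vec_eq_iff axis_def if_distrib[of "\<lambda>c. _ * c"] cong: if_cong)
  show ?thesis
  proof (intro equalityI subsetI)
    fix x :: "real ^ 'n" assume "x \<in> std_simplex"
    then show "x \<in> {x. (\<forall>i. 0 \<le> x $ i) \<and> (\<Sum>i\<in>UNIV. x $ i) = 1}"
      by (auto simp: std_simplex_def convex_hull_finite sum.reindex[OF inj] vec)
  next
    fix x :: "real ^ 'n" assume x: "x \<in> {x. (\<forall>i. 0 \<le> x $ i) \<and> (\<Sum>i\<in>UNIV. x $ i) = 1}"
    \<comment> \<open>\<open>convex_hull_finite\<close> indexes weights by points; the inverse of
      the injection from indices to unit vectors recovers the entry.\<close>
    define u where "u y = x $ inv (\<lambda>i. axis i (1::real)) y" for y
    have "u (axis i 1) = x $ i" for i by (simp add: u_def inv_f_f[OF inj])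
    then show "x \<in> std_simplex"
      using x unfolding std_simplex_def convex_hull_finite[OF finite_imageI[OF finite]]
      by (intro CollectI exI[of _ u]) (auto simp: sum.reindex[OF inj] vec)
  qed
qed

text \<open>The zero sum forces \<open>a $ i = - (n * \<beta>)\<close>, and the unit norm then
  forces n (n+1) \<beta>^2 = 1. Only the sign of \<beta> remains free, and the transposition of i
  and k moves the exceptional entry into place.\<close>

lemma two_valued_eq_a_min:
  fixes a :: "real ^ 'n" and k i :: 'n
  assumes n: "1 \<le> n" "CARD('n) = n + 1" and norm: "norm a = 1" and sum: "(\<Sum>j\<in>UNIV. a $ j) = 0"
    and i: "\<And>j. j \<noteq> i \<Longrightarrow> a $ j = \<beta>"
  shows "\<exists>\<sigma>. \<sigma> permutes UNIV \<and> (a = (\<chi> j. a_min n k $ \<sigma> j) \<or> a = - (\<chi> j. a_min n k $ \<sigma> j))"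
proof -
  have rest: "(\<Sum>j\<in>UNIV - {i}. f (a $ j)) = n * f \<beta>" for f :: "real \<Rightarrow> real"
    using i n(2) by (simp add: card_Diff_singleton)
  have ai: "a $ i = - (n * \<beta>)"
    using sum rest[of "\<lambda>x. x"] by (simp add: sum.remove[of UNIV i])
  have "(\<Sum>j\<in>UNIV. (a $ j)\<^sup>2) = 1"
    using norm by (simp add: norm_eq_1 inner_vec_def power2_eq_square)
  then have "(n * \<beta>)\<^sup>2 + n * \<beta>\<^sup>2 = 1"
    using rest[of "\<lambda>x. x\<^sup>2"] by (simp add: sum.remove[of UNIV i] ai)
  then have sq: "(real n * (real n + 1)) * \<beta>\<^sup>2 = 1"
    by (simp add: power_mult_distrib power2_eq_square algebra_simps)
  define r where "r = sqrt (real n * (real n + 1))"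
  have r: "0 < r" using n by (simp add: r_def)
  have "(r * \<beta>)\<^sup>2 = 1" using sq by (simp add: r_def power_mult_distrib)
  then have "r * \<beta> = 1 \<or> r * \<beta> = - 1" by (simp add: power2_eq_1_iff)
  then have \<beta>: "\<beta> = - (1 / r) \<or> \<beta> = 1 / r" using r by (auto simp: field_simps)
  have nr: "n / r = sqrt (real n / (real n + 1))"
    using n by (simp add: r_def real_sqrt_mult real_sqrt_divide real_div_sqrt flip: divide_divide_eq_left)
  have \<sigma>: "Transposition.transpose i k j = k \<longleftrightarrow> j = i" for j
    by (metis transpose_apply_first transpose_involutory)
  have "a = (\<chi> j. a_min n k $ Transposition.transpose i k j) \<or> a = - (\<chi> j. a_min n k $ Transposition.transpose i k j)"
    using \<beta> i ai by (auto simp: vec_eq_iff a_min_def \<sigma> simp flip: nr r_def)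
  then show ?thesis
    using permutes_swap_id[of i UNIV k] by blast
qed

theorem proposition3:
  fixes n :: nat and a :: "real ^ 'n" and k :: 'n
  assumes "n \<ge> 1"
    and "CARD('n) = n + 1"
    and "norm a = 1"
    and "(\<Sum>j\<in>UNIV. a $ j) = 0"
    and "card (range (\<lambda>j. a $ j)) = 2"
  shows "Vol (n - 1) (std_simplex \<inter> orth_hyperplane a) \<ge> V_min n \<and>
    (Vol (n - 1) (std_simplex \<inter> orth_hyperplane a) = V_min n \<longrightarrow>
      (\<exists>\<sigma>. \<sigma> permutes UNIV \<and>
        (a = (\<chi> j. a_min n k $ \<sigma> j) \<or> a = - (\<chi> j. a_min n k $ \<sigma> j))))"
proof -
  obtain \<alpha> \<beta> where range: "range (\<lambda>j. a $ j) = {\<alpha>, \<beta>}" and ne: "\<alpha> \<noteq> \<beta>"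
    using assms(5) by (auto simp: card_2_iff)
  define P where "P = {j. a $ j = \<alpha>}"
  define Q where "Q = {j. a $ j = \<beta>}"
  have val: "a $ j = \<alpha> \<or> a $ j = \<beta>" for j using range by auto
  have PQ: "P \<union> Q = UNIV" "P \<inter> Q = {}" using val ne by (auto simp: P_def Q_def)
  have "\<alpha> \<in> range (\<lambda>j. a $ j)" "\<beta> \<in> range (\<lambda>j. a $ j)" using range by auto
  then have PQ_ne: "P \<noteq> {}" "Q \<noteq> {}" by (auto simp: P_def Q_def)
  define p where "p = card P"
  define q where "q = card Q"
  have p: "0 < p" and q: "0 < q" using PQ_ne by (auto simp: p_def q_def card_gt_0_iff)
  have N: "p + q = n + 1"
    using card_Un_disjoint[of P Q] PQ assms(2) by (simp add: p_def q_def)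
  have split: "(\<Sum>j\<in>UNIV. f j) = (\<Sum>j\<in>P. f j) + (\<Sum>j\<in>Q. f j)" for f :: "'n \<Rightarrow> real"
    unfolding PQ(1)[symmetric] using PQ(2) by (intro sum.union_disjoint) auto
  have balance: "p * \<alpha> + q * \<beta> = 0"
    using assms(4) unfolding split by (simp add: P_def Q_def p_def q_def)
  have "a \<bullet> x = (\<Sum>j\<in>P. a $ j * x $ j) + (\<Sum>j\<in>Q. a $ j * x $ j)" for x
    unfolding inner_vec_def split[symmetric] by simp
  then have inner: "a \<bullet> x = \<alpha> * (\<Sum>j\<in>P. x $ j) + \<beta> * (\<Sum>j\<in>Q. x $ j)" for x
    by (simp add: P_def Q_def sum_distrib_left)
  \<comment> \<open>As \<alpha> and \<beta> differ, the two equations have a unique solution; by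
    \<open>balance\<close>, it is proportional to (p, q).\<close>
  have solve: "X + Y = 1 \<and> \<alpha> * X + \<beta> * Y = 0 \<longleftrightarrow> X = p / (real n + 1) \<and> Y = q / (real n + 1)" for X Y
  proof
    have Nr: "real p + real q = real n + 1" using N by (metis of_nat_add of_nat_1)
    assume XY: "X + Y = 1 \<and> \<alpha> * X + \<beta> * Y = 0"
    then have Y: "Y = 1 - X" by simp
    have "(\<alpha> - \<beta>) * ((real n + 1) * X) = (\<alpha> - \<beta>) * p"
      using XY balance unfolding Y Nr[symmetric] by algebra
    then have "(real n + 1) * X = p" using ne by simp
    then show "X = p / (real n + 1) \<and> Y = q / (real n + 1)"
      using Nr unfolding Y by (simp add: field_simps)
  next
    have Nr: "real p + real q = real n + 1" using N by (metis of_nat_add of_nat_1)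
    assume "X = p / (real n + 1) \<and> Y = q / (real n + 1)"
    then show "X + Y = 1 \<and> \<alpha> * X + \<beta> * Y = 0"
      using Nr balance by (simp add: mult.commute flip: add_divide_distrib)
  qed
  have slice: "std_simplex \<inter> orth_hyperplane a =
      {x. (\<forall>i. 0 \<le> x $ i) \<and> (\<Sum>i\<in>P. x $ i) = p / (real n + 1) \<and> (\<Sum>i\<in>Q. x $ i) = q / (real n + 1)}"
    (is "_ = ?S")
  proof (rule set_eqI)
    fix x
    show "x \<in> std_simplex \<inter> orth_hyperplane a \<longleftrightarrow> x \<in> ?S"
      using solve[of "\<Sum>i\<in>P. x $ i" "\<Sum>i\<in>Q. x $ i"]
      unfolding std_simplex_eq orth_hyperplane_def Int_iff mem_Collect_eq inner split by blast
  qed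
  have Vol: "Vol (n - 1) (std_simplex \<inter> orth_hyperplane a) =
      simplex_factor p * simplex_factor q / (real n + 1) ^ (n - 1)"
    unfolding slice using Vol_simplex_product[OF PQ PQ_ne, of "p / (real n + 1)" "q / (real n + 1)" "n - 1"]
      p q assms(1,2) slice_volume_eq[OF p q N] by (simp add: p_def q_def)
  have N': "p + q - 1 = n" using N by simp
  \<comment> \<open>A singleton block gives the value \<open>V_min n\<close> exactly, and a is then
    determined. If both blocks have at least two elements, the inequality is strict and the claim on
    equality is vacuous.\<close>
  consider (vertex) i where "P = {i} \<or> Q = {i}" | (interior) "2 \<le> p" "2 \<le> q"
  proof -
    have "p = 1 \<or> q = 1 \<or> 2 \<le> p \<and> 2 \<le> q" using p q by linarith
    then show ?thesis
      using that by (auto simp: p_def q_def card_1_singleton_iff)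
  qed
  then show ?thesis
  proof cases
    case vertex
    have "simplex_factor 1 = 1" by (simp add: simplex_factor_def)
    moreover have "p = 1 \<and> q = n \<or> q = 1 \<and> p = n"
      using vertex N by (auto simp: p_def q_def)
    ultimately have "Vol (n - 1) (std_simplex \<inter> orth_hyperplane a) = V_min n"
      unfolding Vol V_min_eq[OF assms(1)] by auto
    moreover have "j \<in> P \<and> a $ j = \<alpha> \<or> j \<in> Q \<and> a $ j = \<beta>" for j
      using val by (simp add: P_def Q_def)
    then have rest: "a $ j = (if P = {i} then \<beta> else \<alpha>)" if "j \<noteq> i" for j
      using vertex that by (metis singletonD)
    ultimately show ?thesis
      using two_valued_eq_a_min[OF assms(1-4) rest, where k = k] by simp
  next
    case interior
    then have "V_min n < Vol (n - 1) (std_simplex \<inter> orth_hyperplane a)"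
      unfolding Vol V_min_eq[OF assms(1)] using simplex_factor_mult_less[OF interior, unfolded N']
      by (intro divide_strict_right_mono) simp_all
    then show ?thesis by simp
  qed
qed

end
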